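(* Let $\mathcal{G}$ be the weighted product stochastic game built from a finite stochastic game $\mathcal{G}_0$ and scLTL specifications $\phi_1,\dots,\phi_n$ with rewards $r(\phi_i)$, and consider the heuristic value-iteration algorithm (Algorithm 1) described in the context, run on $\mathcal{G}$ with a finite nonempty set $\mathcal{H}=\{V_{C,1},\dots,V_{C,|\mathcal{H}|}\}$ of initial controller value vectors and a tolerance $\epsilon>0$. Then Algorithm 1 converges in finite time, i.e. it terminates after finitely many iterations of its outer and inner loops.
   Context: **Stochastic game.** $\mathcal{G}_0=(S,U_C,U_A,Pr,\Pi,\mathcal{L})$: $S$ finite set of states; $U_C,U_A$ finite action sets of controller and adversary, with nonempty admissible subsets $U_C(s),U_A(s)$ at state $s$; $Pr(s,u_C,u_A,s')$ the probability of moving from $s$ to $s'$ under actions $u_C,u_A$ chosen simultaneously; $\Pi$ atomic propositions; $\mathcal{L}:S\to 2^\Pi$ a labeling. **Specifications.** Each $\phi_i$ is a syntactically co-safe LTL formula (satisfied by a word iff the word has a finite good prefix, any continuation of which satisfies $\phi_i$), with reward $r(\phi_i)\ge 0$. $\mathcal{A}_i=(Q^i,q_0^i,\Sigma,\delta^i,F^i)$, $\Sigma=2^\Pi$, is a complete deterministic finite automaton for $\phi_i$ accepting its good prefixes; once an accepting state is reached the run stays in $F^i$, so a trace collects the reward of $\phi_i$ only when $\phi_i$ is satisfied for the first time. **Product game.** $S_\mathcal{P}=S\times Q^1\times\dots\times Q^n$, with admissible actions inherited from the $S$-component. $Pr_\mathcal{P}((s,q^1,\dots,q^n),u_C,u_A,(s',{q^1}',\dots,{q^n}'))=Pr(s,u_C,u_A,s')$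 if $\delta^i(q^i,\mathcal{L}(s'))={q^i}'$ for all $i$, and $0$ otherwise. The weight is $W((s,q^1,\dots,q^n),u_C,u_A,(s',{q^1}',\dots,{q^n}'))=\sum_{i=1}^n I_{ii'}\,r(\phi_i)$, where $I_{ii'}=1$ if $q^i\notin F^i$ and ${q^i}'\in F^i$, and $I_{ii'}=0$ otherwise. $\gamma$ is an initial probability distribution on $S_\mathcal{P}$. **Policies.** A (stationary) controller policy $\mu$ assigns to each $s_\mathcal{P}$ a probability distribution $\mu(s_\mathcal{P},\cdot)$ on $U_C(s_\mathcal{P})$; an adversary policy $\lambda$ assigns to each $s_\mathcal{P}$ a distribution $\lambda(s_\mathcal{P},\cdot)$ on $U_A(s_\mathcal{P})$. For a fixed $\alpha\in[0,1]$ (anchoring bias) the adversary perceives $\tilde\mu(s_\mathcal{P},u_C)=\alpha\frac{1}{|U_C(s_\mathcal{P})|}+(1-\alpha)\mu(s_\mathcal{P},u_C)$. **Program MILP.** Given vectors $V_C^k,V_A^k\in\mathbb{R}^{S_\mathcal{P}}$ put $$B_C^k(s_\mathcal{P},\mu,u_A)=\sum_{u_C}\mu(s_\mathcal{P},u_C)\sum_{s_\mathcal{P}'}Pr_\mathcal{P}(s_\mathcal{P},u_C,u_A,s_\mathcal{P}')\bigl(W(s_\mathcal{P},u_C,u_A,s_\mathcal{P}')+V_C^k(s_\mathcal{P}')\bigr),$$ $$B_A^k(s_\mathcal{P},\tilde\mu,u_A)=\sum_{u_C}\tilde\mu(s_\mathcal{P},u_C)\sum_{s_\mathcal{P}'}Pr_\mathcal{P}(s_\mathcal{P},u_C,u_A,s_\mathcal{P}')\bigl(-W(s_\mathcal{P},u_C,u_A,s_\mathcal{P}')+V_A^k(s_\mathcal{P}')\bigr).$$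 The MILP is: maximize $\gamma^TV_C$ over $(\mu,\lambda,V_C,V_A)$ subject to: $\mu$ is a controller policy, $\tilde\mu$ is given by the formula above, $\lambda(s_\mathcal{P},u_A)\in\{0,1\}$ with $\sum_{u_A\in U_A(s_\mathcal{P})}\lambda(s_\mathcal{P},u_A)=1$, and for all $s_\mathcal{P},u_A$: $V_C(s_\mathcal{P})\le B_C^k(s_\mathcal{P},\mu,u_A)+(1-\lambda(s_\mathcal{P},u_A))Z$ and $B_A^k(s_\mathcal{P},\tilde\mu,u_A)\le V_A(s_\mathcal{P})\le B_A^k(s_\mathcal{P},\tilde\mu,u_A)+(1-\lambda(s_\mathcal{P},u_A))Z$, where $Z$ is a sufficiently large positive number. **Algorithm 1.** 1. Initialise: sample finitely many controller policies; for each, let the adversary play optimally on the induced Markov decision process, and let $V_{C,t}$ ($t=1,\dots,|\mathcal{H}|$) be the resulting vector of expected total controller rewards, with $V_{A,t}$ the corresponding vector of adversary values (expected total reward of $-W$ as perceived by the adversary). Put $\mathcal{H}=\{V_{C,1},\dots,V_{C,|\mathcal{H}|}\}$, $\mathcal{V}=\emptyset$. 2. (Outer loop) For each $V_{C,t}\in\mathcal{H}$: set $V_C^0=V_{C,t}$, $V_A^0=V_{A,t}$, $k=0$. (Inner loop) Repeat: solve the MILP with data $V_C^k,V_A^k$; let $(\mu^{k+1},\lambda^{k+1},V_C^{k+1},V_A^{k+1})$ be an optimal solution; set $k\leftarrow k+1$; until $\gamma^TV_C^k-\gamma^TV_C^{k-1}\le\epsilon$ or the MILP is infeasible. If the inner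 loop stopped because $\gamma^TV_C^k-\gamma^TV_C^{k-1}\le\epsilon$, add $\gamma^TV_C^k$ to $\mathcal{V}$. 3. If $\mathcal{V}=\emptyset$, return to step 2. Otherwise return the controller policy corresponding to the maximum value in $\mathcal{V}$. *)

theory Defs
  imports Complex_Main "HOL-Library.FuncSet" "HOL-Library.Stream"
begin

section \<open>Stochastic games\<close>

record ('x, 'c, 'a) game =
  states :: "'x set"
  ctrl_acts :: "'c set"
  adv_acts :: "'a set"
  ctrl_adm :: "'x \<Rightarrow> 'c set"
  adv_adm :: "'x \<Rightarrow> 'a set"
  tprob :: "'x \<Rightarrow> 'c \<Rightarrow> 'a \<Rightarrow> 'x \<Rightarrow> real"

record ('x, 'c, 'a, 'p) labelled_game = "('x, 'c, 'a) game" +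
  props :: "'p set"
  label :: "'x \<Rightarrow> 'p set"

record ('x, 'c, 'a) weighted_game = "('x, 'c, 'a) game" +
  weight :: "'x \<Rightarrow> 'c \<Rightarrow> 'a \<Rightarrow> 'x \<Rightarrow> real"

definition stochastic_game :: "('s, 'c, 'a, 'p) labelled_game \<Rightarrow> bool" where
  "stochastic_game G \<longleftrightarrow>
     finite (states G) \<and> finite (ctrl_acts G) \<and> finite (adv_acts G) \<and>
     (\<forall>s \<in> states G.
        ctrl_adm G s \<noteq> {} \<and> ctrl_adm G s \<subseteq> ctrl_acts G \<and>
        adv_adm G s \<noteq> {} \<and> adv_adm G s \<subseteq> adv_acts G \<and>
        label G s \<subseteq> props G \<and>
        (\<forall>c \<in> ctrl_adm G s. \<forall>a \<in> adv_adm G s.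
           (\<forall>s' \<in> states G. 0 \<le> tprob G s c a s') \<and>
           (\<Sum>s' \<in> states G. tprob G s c a s') = 1))"


section \<open>Syntactically co-safe LTL and automata for good prefixes\<close>

text \<open>Negation is applied to atoms only, and the temporal operators are next, until and
  eventually; this is what makes a formula syntactically co-safe.\<close>

datatype 'p scltl =
    TrueF
  | FalseF
  | Atom 'p
  | NegAtom 'p
  | And "'p scltl" "'p scltl"
  | Or "'p scltl" "'p scltl"
  | Next "'p scltl"
  | Until "'p scltl" "'p scltl"
  | Eventually "'p scltl"

primrec sat :: "'p scltl \<Rightarrow> 'p set stream \<Rightarrow> bool" where
  "sat TrueF \<omega> \<longleftrightarrow> True"
| "sat FalseF \<omega> \<longleftrightarrow> False"
| "sat (Atom p) \<omega> \<longleftrightarrow> p \<in> shd \<omega>"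
| "sat (NegAtom p) \<omega> \<longleftrightarrow> p \<notin> shd \<omega>"
| "sat (And f g) \<omega> \<longleftrightarrow> sat f \<omega> \<and> sat g \<omega>"
| "sat (Or f g) \<omega> \<longleftrightarrow> sat f \<omega> \<or> sat g \<omega>"
| "sat (Next f) \<omega> \<longleftrightarrow> sat f (stl \<omega>)"
| "sat (Until f g) \<omega> \<longleftrightarrow> (\<exists>i. sat g (sdrop i \<omega>) \<and> (\<forall>j<i. sat f (sdrop j \<omega>)))"
| "sat (Eventually f) \<omega> \<longleftrightarrow> (\<exists>i. sat f (sdrop i \<omega>))"

definition good_prefix :: "'p set \<Rightarrow> 'p scltl \<Rightarrow> 'p set list \<Rightarrow> bool" where
  "good_prefix AP \<phi> w \<longleftrightarrow> (\<forall>\<omega> \<in> streams (Pow AP). sat \<phi> (w @- \<omega>))"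

record ('q, 'p) dfa =
  dstates :: "'q set"
  dinit :: "'q"
  dnext :: "'q \<Rightarrow> 'p set \<Rightarrow> 'q"
  dacc :: "'q set"

text \<open>The alphabet is \<^term>\<open>Pow AP\<close>. The last conjunct concerns every accepting state, including
  those unreachable from \<^const>\<open>dinit\<close>: product runs may start in any product state.\<close>

definition good_prefix_dfa :: "'p set \<Rightarrow> 'p scltl \<Rightarrow> ('q, 'p) dfa \<Rightarrow> bool" where
  "good_prefix_dfa AP \<phi> A \<longleftrightarrow>
     finite (dstates A) \<and> dinit A \<in> dstates A \<and> dacc A \<subseteq> dstates A \<and>
     (\<forall>q \<in> dstates A. \<forall>\<sigma> \<in> Pow AP. dnext A q \<sigma> \<in> dstates A) \<and>
     (\<forall>w \<in> lists (Pow AP). foldl (dnext A) (dinit A) w \<in> dacc A \<longleftrightarrow> good_prefix AP \<phi> w) \<and>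
     (\<forall>q \<in> dacc A. \<forall>\<sigma> \<in> Pow AP. dnext A q \<sigma> \<in> dacc A)"

definition scltl_specs ::
  "'p set \<Rightarrow> nat \<Rightarrow> (nat \<Rightarrow> 'p scltl) \<Rightarrow> ('p scltl \<Rightarrow> real) \<Rightarrow> (nat \<Rightarrow> ('q, 'p) dfa) \<Rightarrow> bool" where
  "scltl_specs AP n \<phi> r A \<longleftrightarrow>
     (\<forall>i \<in> {1..n}. set_scltl (\<phi> i) \<subseteq> AP \<and> 0 \<le> r (\<phi> i) \<and> good_prefix_dfa AP (\<phi> i) (A i))"


section \<open>Weighted product game\<close>

text \<open>A product state is a pair of a game state and an extensional family of automaton states
  indexed by \<open>1, \<dots>, n\<close>. The automata have carriers of their own inside a common type.\<close>

definition product_game ::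
  "('s, 'c, 'a, 'p) labelled_game \<Rightarrow> nat \<Rightarrow> (nat \<Rightarrow> 'p scltl) \<Rightarrow> ('p scltl \<Rightarrow> real) \<Rightarrow>
   (nat \<Rightarrow> ('q, 'p) dfa) \<Rightarrow> ('s \<times> (nat \<Rightarrow> 'q), 'c, 'a) weighted_game" where
  "product_game G n \<phi> r A =
     \<lparr> states = states G \<times> (\<Pi>\<^sub>E i \<in> {1..n}. dstates (A i)),
       ctrl_acts = ctrl_acts G,
       adv_acts = adv_acts G,
       ctrl_adm = (\<lambda>(s, q). ctrl_adm G s),
       adv_adm = (\<lambda>(s, q). adv_adm G s),
       tprob = (\<lambda>(s, q) c a (s', q').
          if \<forall>i \<in> {1..n}. dnext (A i) (q i) (label G s') = q' i then tprob G s c a s' else 0),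
       weight = (\<lambda>(s, q) c a (s', q').
          \<Sum>i = 1..n. if q i \<notin> dacc (A i) \<and> q' i \<in> dacc (A i) then r (\<phi> i) else 0) \<rparr>"

definition state_distribution :: "('x, 'c, 'a) weighted_game \<Rightarrow> ('x \<Rightarrow> real) \<Rightarrow> bool" where
  "state_distribution P \<gamma> \<longleftrightarrow> (\<forall>x \<in> states P. 0 \<le> \<gamma> x) \<and> (\<Sum>x \<in> states P. \<gamma> x) = 1"


section \<open>Policies and expected total rewards\<close>

definition ctrl_policy :: "('x, 'c, 'a) weighted_game \<Rightarrow> ('x \<Rightarrow> 'c \<Rightarrow> real) \<Rightarrow> bool" where
  "ctrl_policy P \<mu> \<longleftrightarrow>
     (\<forall>x \<in> states P. (\<forall>c \<in> ctrl_adm P x. 0 \<le> \<mu> x c) \<and> (\<Sum>c \<in> ctrl_adm P x. \<mu> x c) = 1)"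

definition adv_policy :: "('x, 'c, 'a) weighted_game \<Rightarrow> ('x \<Rightarrow> 'a \<Rightarrow> real) \<Rightarrow> bool" where
  "adv_policy P lam \<longleftrightarrow>
     (\<forall>x \<in> states P. (\<forall>a \<in> adv_adm P x. 0 \<le> lam x a) \<and> (\<Sum>a \<in> adv_adm P x. lam x a) = 1)"

definition perceived ::
  "('x, 'c, 'a) weighted_game \<Rightarrow> real \<Rightarrow> ('x \<Rightarrow> 'c \<Rightarrow> real) \<Rightarrow> 'x \<Rightarrow> 'c \<Rightarrow> real" where
  "perceived P \<alpha> \<mu> x c = \<alpha> * (1 / real (card (ctrl_adm P x))) + (1 - \<alpha>) * \<mu> x c"

definition step_prob ::
  "('x, 'c, 'a) weighted_game \<Rightarrow> ('x \<Rightarrow> 'c \<Rightarrow> real) \<Rightarrow> ('x \<Rightarrow> 'a \<Rightarrow> real) \<Rightarrow> 'x \<Rightarrow> 'x \<Rightarrow> real" where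
  "step_prob P \<mu> lam x y =
     (\<Sum>c \<in> ctrl_adm P x. \<Sum>a \<in> adv_adm P x. \<mu> x c * lam x a * tprob P x c a y)"

text \<open>\<^term>\<open>visit_prob P \<mu> lam x t y\<close> is the probability of being in \<open>y\<close> at time \<open>t\<close> when starting
  in \<open>x\<close>.\<close>

primrec visit_prob ::
  "('x, 'c, 'a) weighted_game \<Rightarrow> ('x \<Rightarrow> 'c \<Rightarrow> real) \<Rightarrow> ('x \<Rightarrow> 'a \<Rightarrow> real) \<Rightarrow>
   'x \<Rightarrow> nat \<Rightarrow> 'x \<Rightarrow> real" where
  "visit_prob P \<mu> lam x 0 y = (if y = x then 1 else 0)"
| "visit_prob P \<mu> lam x (Suc t) y =
     (\<Sum>z \<in> states P. visit_prob P \<mu> lam x t z * step_prob P \<mu> lam z y)"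

text \<open>Expected total reward over the infinite horizon, as the sum over \<open>t\<close> of the expected reward
  of the transition from time \<open>t\<close> to time \<open>t + 1\<close>.\<close>

definition total_reward ::
  "('x, 'c, 'a) weighted_game \<Rightarrow> ('x \<Rightarrow> 'c \<Rightarrow> 'a \<Rightarrow> 'x \<Rightarrow> real) \<Rightarrow>
   ('x \<Rightarrow> 'c \<Rightarrow> real) \<Rightarrow> ('x \<Rightarrow> 'a \<Rightarrow> real) \<Rightarrow> 'x \<Rightarrow> real" where
  "total_reward P w \<mu> lam x =
     (\<Sum>t. \<Sum>y \<in> states P. visit_prob P \<mu> lam x t y *
        (\<Sum>c \<in> ctrl_adm P y. \<Sum>a \<in> adv_adm P y. \<Sum>y' \<in> states P.
           \<mu> y c * lam y a * tprob P y c a y' * w y c a y'))"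

definition neg_weight :: "('x, 'c, 'a) weighted_game \<Rightarrow> 'x \<Rightarrow> 'c \<Rightarrow> 'a \<Rightarrow> 'x \<Rightarrow> real" where
  "neg_weight P x c a y = - weight P x c a y"

text \<open>Once the controller policy is fixed, the adversary faces a Markov decision process. He
  optimises the reward \<open>-W\<close> in the process that he perceives, i.e. against the perceived policy.\<close>

definition best_response ::
  "('x, 'c, 'a) weighted_game \<Rightarrow> real \<Rightarrow> ('x \<Rightarrow> 'c \<Rightarrow> real) \<Rightarrow> ('x \<Rightarrow> 'a \<Rightarrow> real) \<Rightarrow> bool" where
  "best_response P \<alpha> \<mu> lam \<longleftrightarrow>
     adv_policy P lam \<and>
     (\<forall>lam'. adv_policy P lam' \<longrightarrow>
        (\<forall>x \<in> states P. total_reward P (neg_weight P) (perceived P \<alpha> \<mu>) lam' x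
                     \<le> total_reward P (neg_weight P) (perceived P \<alpha> \<mu>) lam x))"

text \<open>\<open>(V\<^sub>C, V\<^sub>A)\<close> is a pair of value vectors that the initialisation may compute from the sampled
  controller policy \<open>\<mu>\<close>.\<close>

definition initial_values ::
  "('x, 'c, 'a) weighted_game \<Rightarrow> real \<Rightarrow> ('x \<Rightarrow> 'c \<Rightarrow> real) \<Rightarrow>
   ('x \<Rightarrow> real) \<times> ('x \<Rightarrow> real) \<Rightarrow> bool" where
  "initial_values P \<alpha> \<mu> V \<longleftrightarrow>
     ctrl_policy P \<mu> \<and>
     (\<exists>lam. best_response P \<alpha> \<mu> lam \<and>
        (\<forall>x \<in> states P.
           fst V x = total_reward P (weight P) \<mu> lam x \<and>
           snd V x = total_reward P (neg_weight P) (perceived P \<alpha> \<mu>) lam x))"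


section \<open>The mixed-integer linear program\<close>

definition backup_ctrl ::
  "('x, 'c, 'a) weighted_game \<Rightarrow> ('x \<Rightarrow> real) \<Rightarrow> 'x \<Rightarrow> ('x \<Rightarrow> 'c \<Rightarrow> real) \<Rightarrow> 'a \<Rightarrow> real" where
  "backup_ctrl P V x \<mu> a =
     (\<Sum>c \<in> ctrl_adm P x. \<mu> x c * (\<Sum>y \<in> states P. tprob P x c a y * (weight P x c a y + V y)))"

definition backup_adv ::
  "('x, 'c, 'a) weighted_game \<Rightarrow> ('x \<Rightarrow> real) \<Rightarrow> 'x \<Rightarrow> ('x \<Rightarrow> 'c \<Rightarrow> real) \<Rightarrow> 'a \<Rightarrow> real" where
  "backup_adv P V x \<mu> a =
     (\<Sum>c \<in> ctrl_adm P x. \<mu> x c * (\<Sum>y \<in> states P. tprob P x c a y * (- weight P x c a y + V y)))"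

definition objective :: "('x, 'c, 'a) weighted_game \<Rightarrow> ('x \<Rightarrow> real) \<Rightarrow> ('x \<Rightarrow> real) \<Rightarrow> real" where
  "objective P \<gamma> V = (\<Sum>x \<in> states P. \<gamma> x * V x)"

definition milp_feasible ::
  "('x, 'c, 'a) weighted_game \<Rightarrow> real \<Rightarrow> real \<Rightarrow> ('x \<Rightarrow> real) \<Rightarrow> ('x \<Rightarrow> real) \<Rightarrow>
   ('x \<Rightarrow> 'c \<Rightarrow> real) \<Rightarrow> ('x \<Rightarrow> 'a \<Rightarrow> real) \<Rightarrow> ('x \<Rightarrow> real) \<Rightarrow> ('x \<Rightarrow> real) \<Rightarrow> bool" where
  "milp_feasible P \<alpha> Z VCk VAk \<mu> lam VC VA \<longleftrightarrow>
     ctrl_policy P \<mu> \<and>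
     (\<forall>x \<in> states P.
        (\<Sum>a \<in> adv_adm P x. lam x a) = 1 \<and>
        (\<forall>a \<in> adv_adm P x.
           lam x a \<in> {0, 1} \<and>
           VC x \<le> backup_ctrl P VCk x \<mu> a + (1 - lam x a) * Z \<and>
           backup_adv P VAk x (perceived P \<alpha> \<mu>) a \<le> VA x \<and>
           VA x \<le> backup_adv P VAk x (perceived P \<alpha> \<mu>) a + (1 - lam x a) * Z))"

definition milp_infeasible ::
  "('x, 'c, 'a) weighted_game \<Rightarrow> real \<Rightarrow> real \<Rightarrow> ('x \<Rightarrow> real) \<Rightarrow> ('x \<Rightarrow> real) \<Rightarrow> bool" where
  "milp_infeasible P \<alpha> Z VCk VAk \<longleftrightarrow> (\<nexists>\<mu> lam VC VA. milp_feasible P \<alpha> Z VCk VAk \<mu> lam VC VA)"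

definition milp_optimal ::
  "('x, 'c, 'a) weighted_game \<Rightarrow> ('x \<Rightarrow> real) \<Rightarrow> real \<Rightarrow> real \<Rightarrow> ('x \<Rightarrow> real) \<Rightarrow> ('x \<Rightarrow> real) \<Rightarrow>
   ('x \<Rightarrow> 'c \<Rightarrow> real) \<Rightarrow> ('x \<Rightarrow> 'a \<Rightarrow> real) \<Rightarrow> ('x \<Rightarrow> real) \<Rightarrow> ('x \<Rightarrow> real) \<Rightarrow> bool" where
  "milp_optimal P \<gamma> \<alpha> Z VCk VAk \<mu> lam VC VA \<longleftrightarrow>
     milp_feasible P \<alpha> Z VCk VAk \<mu> lam VC VA \<and>
     (\<forall>\<mu>' lam' VC' VA'. milp_feasible P \<alpha> Z VCk VAk \<mu>' lam' VC' VA' \<longrightarrow>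
        objective P \<gamma> VC' \<le> objective P \<gamma> VC)"


section \<open>The algorithm as a transition system\<close>

text \<open>The two arguments shared by \<open>Outer\<close> and \<open>Inner\<close> are the initial value pairs
  still to be processed by the outer loop, and the values found so far, each with its policy. The
  last two arguments of \<open>Inner\<close> are the data \<open>V\<^sub>C\<^sup>k\<close>, \<open>V\<^sub>A\<^sup>k\<close> of the next program.\<close>

datatype ('x, 'c) config =
    Outer "(('x \<Rightarrow> real) \<times> ('x \<Rightarrow> real)) list" "(real \<times> ('x \<Rightarrow> 'c \<Rightarrow> real)) set"
  | Inner "(('x \<Rightarrow> real) \<times> ('x \<Rightarrow> real)) list" "(real \<times> ('x \<Rightarrow> 'c \<Rightarrow> real)) set"
      "'x \<Rightarrow> real" "'x \<Rightarrow> real"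
  | Returned "'x \<Rightarrow> 'c \<Rightarrow> real"

text \<open>The relation is nondeterministic, as a program may have several optimal solutions. If a
  program were feasible but had no optimal solution, the algorithm would be stuck in a
  configuration which is not of the form \<open>Returned \<mu>\<close>.\<close>

inductive alg_step ::
  "('x, 'c, 'a) weighted_game \<Rightarrow> ('x \<Rightarrow> real) \<Rightarrow> real \<Rightarrow> real \<Rightarrow> real \<Rightarrow>
   (('x \<Rightarrow> real) \<times> ('x \<Rightarrow> real)) list \<Rightarrow> ('x, 'c) config \<Rightarrow> ('x, 'c) config \<Rightarrow> bool"
  for P \<gamma> \<alpha> Z \<epsilon> H where
  start_inner:
    "alg_step P \<gamma> \<alpha> Z \<epsilon> H (Outer ((VC, VA) # vs) \<V>) (Inner vs \<V> VC VA)"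
| continue_inner:
    "milp_optimal P \<gamma> \<alpha> Z VCk VAk \<mu> lam VC VA \<Longrightarrow>
     objective P \<gamma> VC - objective P \<gamma> VCk > \<epsilon> \<Longrightarrow>
     alg_step P \<gamma> \<alpha> Z \<epsilon> H (Inner vs \<V> VCk VAk) (Inner vs \<V> VC VA)"
| stop_inner:
    "milp_optimal P \<gamma> \<alpha> Z VCk VAk \<mu> lam VC VA \<Longrightarrow>
     objective P \<gamma> VC - objective P \<gamma> VCk \<le> \<epsilon> \<Longrightarrow>
     alg_step P \<gamma> \<alpha> Z \<epsilon> H (Inner vs \<V> VCk VAk) (Outer vs (insert (objective P \<gamma> VC, \<mu>) \<V>))"
| infeasible_inner:
    "milp_infeasible P \<alpha> Z VCk VAk \<Longrightarrow>
     alg_step P \<gamma> \<alpha> Z \<epsilon> H (Inner vs \<V> VCk VAk) (Outer vs \<V>)"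
| repeat_outer:
    "alg_step P \<gamma> \<alpha> Z \<epsilon> H (Outer [] {}) (Outer H {})"
| finish:
    "(v, \<mu>) \<in> \<V> \<Longrightarrow> (\<forall>(v', \<mu>') \<in> \<V>. v' \<le> v) \<Longrightarrow>
     alg_step P \<gamma> \<alpha> Z \<epsilon> H (Outer [] \<V>) (Returned \<mu>)"

definition terminates :: "('d \<Rightarrow> 'd \<Rightarrow> bool) \<Rightarrow> ('d \<Rightarrow> bool) \<Rightarrow> 'd \<Rightarrow> bool" where
  "terminates step fin d \<longleftrightarrow>
     (\<nexists>\<rho> :: nat \<Rightarrow> 'd. \<rho> 0 = d \<and> (\<forall>i. step (\<rho> i) (\<rho> (Suc i)))) \<and>
     (\<forall>d'. step\<^sup>*\<^sup>* d d' \<and> (\<nexists>d''. step d' d'') \<longrightarrow> fin d')"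

definition algorithm_terminates ::
  "('x, 'c, 'a) weighted_game \<Rightarrow> ('x \<Rightarrow> real) \<Rightarrow> real \<Rightarrow> real \<Rightarrow> real \<Rightarrow>
   (('x \<Rightarrow> real) \<times> ('x \<Rightarrow> real)) list \<Rightarrow> bool" where
  "algorithm_terminates P \<gamma> \<alpha> Z \<epsilon> H \<longleftrightarrow>
     terminates (alg_step P \<gamma> \<alpha> Z \<epsilon> H) (\<lambda>d. \<exists>\<mu>. d = Returned \<mu>) (Outer H {})"

end

theory Submission
  imports Defs
begin

text \<open>The potential \<open>R\<close> of a product state is the total reward of the specifications that it has
  not yet satisfied. A possible transition collects exactly the loss of potential, so every total
  reward lies between \<open>0\<close> and \<open>R\<close>, and these bounds are inherited by the backups: along the
  algorithm \<open>V\<^sub>C\<^sup>k \<le> R\<close> and \<open>-R \<le> V\<^sub>A\<^sup>k \<le> 0\<close>. The second pair of bounds makes every program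
  feasible as soon as \<open>Z\<close> is at least the sum of all rewards, so that each inner loop ends with a
  new element of \<open>\<V>\<close> and the outer loop is never repeated. The first bound makes the inner loop
  finite, because the objective is bounded above and increases by more than \<open>\<epsilon>\<close> each time.
  Finally, a feasible program has an optimal solution: its constraints do not couple different
  states, and for each state the optimum is attained by compactness.\<close>

section \<open>Compactness, averages, ranks and termination arguments\<close>

text \<open>Bolzano-Weierstrass for finitely many coordinates: each induction step refines the
  subsequence found so far by one that is monotone in the new coordinate.\<close>

lemma bounded_family_convergent_subseq:
  fixes f :: "nat \<Rightarrow> 'i \<Rightarrow> real"
  assumes "finite I" and "\<And>i n. i \<in> I \<Longrightarrow> \<bar>f n i\<bar> \<le> B"
  shows "\<exists>\<tau> g. strict_mono \<tau> \<and> (\<forall>i \<in> I. (\<lambda>n. f (\<tau> n) i) \<longlonglongrightarrow> g i)"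
  using assms
proof (induction I rule: finite_induct)
  case empty
  show ?case by (auto intro: exI[of _ id] simp: strict_mono_id)
next
  case (insert j I)
  then obtain \<tau> g where \<tau>: "strict_mono \<tau>" and g: "\<forall>i \<in> I. (\<lambda>n. f (\<tau> n) i) \<longlonglongrightarrow> g i"
    by force
  obtain \<sigma> where \<sigma>: "strict_mono \<sigma>" and mono: "monoseq (\<lambda>n. f (\<tau> (\<sigma> n)) j)"
    using seq_monosub[of "\<lambda>n. f (\<tau> n) j"] by auto
  have "Bseq (\<lambda>n. f (\<tau> (\<sigma> n)) j)"
    using insert.prems by (intro BseqI') auto
  then have "convergent (\<lambda>n. f (\<tau> (\<sigma> n)) j)"
    using mono by (rule Bseq_monoseq_convergent)
  then obtain l where l: "(\<lambda>n. f (\<tau> (\<sigma> n)) j) \<longlonglongrightarrow> l"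
    by (auto simp: convergent_def)
  have "(\<lambda>n. f (\<tau> (\<sigma> n)) i) \<longlonglongrightarrow> g i" if "i \<in> I" for i
    using LIMSEQ_subseq_LIMSEQ[OF g[rule_format, OF that] \<sigma>] by (simp add: o_def)
  with l insert.hyps have "\<forall>i \<in> insert j I. (\<lambda>n. f ((\<tau> \<circ> \<sigma>) n) i) \<longlonglongrightarrow> (g(j := l)) i"
    by auto
  moreover have "strict_mono (\<tau> \<circ> \<sigma>)"
    using \<tau> \<sigma> by (rule strict_mono_o)
  ultimately show ?case by blast
qed

lemma weighted_average_le:
  fixes p v :: "'i \<Rightarrow> real"
  assumes "\<And>i. i \<in> I \<Longrightarrow> 0 \<le> p i" "sum p I = 1" "\<And>i. i \<in> I \<Longrightarrow> v i \<le> b"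
  shows "(\<Sum>i \<in> I. p i * v i) \<le> b"
proof -
  have "(\<Sum>i \<in> I. p i * v i) \<le> (\<Sum>i \<in> I. p i * b)"
    using assms by (intro sum_mono mult_left_mono)
  also have "\<dots> = b"
    using assms(2) by (simp flip: sum_distrib_right)
  finally show ?thesis .
qed

text \<open>\<open>(b - u) / \<epsilon>\<close> bounds the number of increases by more than
  \<epsilon> that remain below \<open>b\<close>. As it exceeds 1 here, its ceiling is positive, so
  truncation by \<open>nat\<close> cannot hide the decrease.\<close>

lemma nat_ceiling_divide_decreasing:
  fixes u u' b \<epsilon> :: real
  assumes "0 < \<epsilon>" "u + \<epsilon> < u'" "u' \<le> b"
  shows "nat \<lceil>(b - u') / \<epsilon>\<rceil> < nat \<lceil>(b - u) / \<epsilon>\<rceil>"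
proof -
  have "(b - u') / \<epsilon> \<le> (b - u - \<epsilon>) / \<epsilon>"
    using assms by (intro divide_right_mono) auto
  also have "\<dots> = (b - u) / \<epsilon> - 1"
    using assms(1) by (simp add: diff_divide_distrib)
  finally have "(b - u') / \<epsilon> \<le> (b - u) / \<epsilon> - 1" .
  then have "\<lceil>(b - u') / \<epsilon>\<rceil> \<le> \<lceil>(b - u) / \<epsilon> - 1\<rceil>"
    by (rule ceiling_mono)
  moreover have "0 < \<lceil>(b - u) / \<epsilon>\<rceil>"
    using assms by simp
  ultimately show ?thesis by simp
qed

text \<open>The decrease along \<open>T\<close> rules out infinite runs, and \<open>progress\<close>
  rules out getting stuck early; both need hold only where \<open>Inv\<close> does.\<close>

lemma terminatesI:
  assumes "wf T" "Inv d"
    and pres: "\<And>d d'. Inv d \<Longrightarrow> step d d' \<Longrightarrow> Inv d' \<and> (d', d) \<in> T"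
    and progress: "\<And>d. Inv d \<Longrightarrow> \<not> fin d \<Longrightarrow> \<exists>d'. step d d'"
  shows "terminates step fin d"
proof -
  have "\<not> (\<rho> 0 = d \<and> (\<forall>i. step (\<rho> i) (\<rho> (Suc i))))" for \<rho>
  proof
    assume \<rho>: "\<rho> 0 = d \<and> (\<forall>i. step (\<rho> i) (\<rho> (Suc i)))"
    have "Inv (\<rho> i)" for i
      using \<rho> \<open>Inv d\<close> pres by (induction i) blast+
    then have "\<forall>i. (\<rho> (Suc i), \<rho> i) \<in> T"
      using \<rho> pres by blast
    then show False
      using \<open>wf T\<close> by (auto simp: wf_iff_no_infinite_down_chain)
  qed
  moreover have "Inv d'" if "step\<^sup>*\<^sup>* d d'" for d'
    using that by induction (use \<open>Inv d\<close> pres in blast)+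
  ultimately show ?thesis
    using progress unfolding terminates_def by blast
qed


section \<open>Games whose weights are differences of a potential\<close>

text \<open>Changing the sign of the values reduces bounds on the adversary's backups to those on
  the controller's.\<close>

lemma backup_adv_eq: "backup_adv P V x \<mu> a = - backup_ctrl P (\<lambda>y. - V y) x \<mu> a"
proof -
  have "(\<Sum>y \<in> states P. tprob P x c a y * (- weight P x c a y + V y))
      = - (\<Sum>y \<in> states P. tprob P x c a y * (weight P x c a y + - V y))" for c
    unfolding sum_negf[symmetric] by (intro sum.cong refl) (simp add: algebra_simps)
  then show ?thesis
    by (simp only: backup_adv_def backup_ctrl_def mult_minus_right sum_negf)
qed

text \<open>The program restricted to one state. Successor values enter as data and not as
  variables, so the constraints decouple; the constant policy \<open>\<lambda>_. m\<close> serves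
  because backups at \<open>x\<close> read only the distribution at \<open>x\<close>.\<close>

definition state_feasible ::
  "('x, 'c, 'a) weighted_game \<Rightarrow> real \<Rightarrow> real \<Rightarrow> ('x \<Rightarrow> real) \<Rightarrow> ('x \<Rightarrow> real) \<Rightarrow>
   'x \<Rightarrow> ('c \<Rightarrow> real) \<Rightarrow> ('a \<Rightarrow> real) \<Rightarrow> real \<Rightarrow> real \<Rightarrow> bool" where
  "state_feasible P \<alpha> Z VCk VAk x m l vc va \<longleftrightarrow>
     (\<forall>c \<in> ctrl_adm P x. 0 \<le> m c) \<and> (\<Sum>c \<in> ctrl_adm P x. m c) = 1 \<and>
     (\<Sum>a \<in> adv_adm P x. l a) = 1 \<and>
     (\<forall>a \<in> adv_adm P x.
        l a \<in> {0, 1} \<and>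
        vc \<le> backup_ctrl P VCk x (\<lambda>_. m) a + (1 - l a) * Z \<and>
        backup_adv P VAk x (perceived P \<alpha> (\<lambda>_. m)) a \<le> va \<and>
        va \<le> backup_adv P VAk x (perceived P \<alpha> (\<lambda>_. m)) a + (1 - l a) * Z)"

lemma milp_feasible_iff:
  "milp_feasible P \<alpha> Z VCk VAk \<mu> lam VC VA \<longleftrightarrow>
     (\<forall>x \<in> states P. state_feasible P \<alpha> Z VCk VAk x (\<mu> x) (lam x) (VC x) (VA x))"
  by (auto simp: milp_feasible_def state_feasible_def ctrl_policy_def backup_ctrl_def
      backup_adv_def perceived_def)

text \<open>A sum of zeros is not 1. At the selected action the term with \<open>Z\<close> vanishes,
  which yields bounds independent of \<open>Z\<close>.\<close>

lemma state_feasible_selects_action: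
  assumes "state_feasible P \<alpha> Z VCk VAk x m l vc va"
  obtains a where "a \<in> adv_adm P x" "l a = 1"
proof -
  have "\<exists>a \<in> adv_adm P x. l a \<noteq> 0"
    using assms unfolding state_feasible_def by (metis sum.neutral zero_neq_one)
  then show thesis
    using assms that unfolding state_feasible_def by blast
qed

text \<open>What the analysis of the algorithm needs from the product game: finiteness, stochastic
  transitions, and a potential that pays for every weight.\<close>

locale potential_game =
  fixes P :: "('x, 'c, 'a) weighted_game" and R :: "'x \<Rightarrow> real"
  assumes finite_states: "finite (states P)"
    and finite_ctrl: "x \<in> states P \<Longrightarrow> finite (ctrl_adm P x)"
    and finite_adv: "x \<in> states P \<Longrightarrow> finite (adv_adm P x)"
    and ctrl_nonempty: "x \<in> states P \<Longrightarrow> ctrl_adm P x \<noteq> {}"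
    and adv_nonempty: "x \<in> states P \<Longrightarrow> adv_adm P x \<noteq> {}"
    and tprob_nonneg:
      "x \<in> states P \<Longrightarrow> c \<in> ctrl_adm P x \<Longrightarrow> a \<in> adv_adm P x \<Longrightarrow> y \<in> states P \<Longrightarrow>
       0 \<le> tprob P x c a y"
    and tprob_sum:
      "x \<in> states P \<Longrightarrow> c \<in> ctrl_adm P x \<Longrightarrow> a \<in> adv_adm P x \<Longrightarrow>
       (\<Sum>y \<in> states P. tprob P x c a y) = 1"
    and weight_nonneg:
      "x \<in> states P \<Longrightarrow> y \<in> states P \<Longrightarrow> 0 \<le> weight P x c a y"
    and potential_nonneg: "x \<in> states P \<Longrightarrow> 0 \<le> R x"
    and potential_step:
      "x \<in> states P \<Longrightarrow> y \<in> states P \<Longrightarrow> tprob P x c a y \<noteq> 0 \<Longrightarrow> weight P x c a y + R y = R x"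
begin

lemma expected_potential_step:
  assumes "x \<in> states P" "c \<in> ctrl_adm P x" "a \<in> adv_adm P x"
  shows "(\<Sum>y \<in> states P. tprob P x c a y * (weight P x c a y + R y)) = R x"
proof -
  \<comment> \<open>Transitions of probability zero make both sides vanish;
    \<open>potential_step\<close> covers the others.\<close>
  have "tprob P x c a y * (weight P x c a y + R y) = tprob P x c a y * R x" if "y \<in> states P" for y
    using potential_step[OF assms(1) that] by force
  then have "(\<Sum>y \<in> states P. tprob P x c a y * (weight P x c a y + R y))
      = (\<Sum>y \<in> states P. tprob P x c a y * R x)"
    by (intro sum.cong refl) auto
  also have "\<dots> = R x"
    using tprob_sum[OF assms] by (simp flip: sum_distrib_right)
  finally show ?thesis .
qed

text \<open>\<open>R\<close> is reproduced by the backup of every action pair; monotonicity in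
  \<open>V\<close> and averaging over the policy give the bound.\<close>

lemma backup_ctrl_le:
  assumes "x \<in> states P" "a \<in> adv_adm P x"
    and "\<forall>c \<in> ctrl_adm P x. 0 \<le> \<mu> x c" "(\<Sum>c \<in> ctrl_adm P x. \<mu> x c) = 1"
    and "\<forall>y \<in> states P. V y \<le> R y"
  shows "backup_ctrl P V x \<mu> a \<le> R x"
  unfolding backup_ctrl_def
proof (rule weighted_average_le)
  fix c assume c: "c \<in> ctrl_adm P x"
  have "(\<Sum>y \<in> states P. tprob P x c a y * (weight P x c a y + V y))
      \<le> (\<Sum>y \<in> states P. tprob P x c a y * (weight P x c a y + R y))"
    using assms c by (intro sum_mono mult_left_mono tprob_nonneg) auto
  then show "(\<Sum>y \<in> states P. tprob P x c a y * (weight P x c a y + V y)) \<le> R x"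
    using expected_potential_step[OF assms(1) c assms(2)] by simp
qed (use assms in auto)

lemma backup_ctrl_nonneg:
  assumes "x \<in> states P" "a \<in> adv_adm P x"
    and "\<forall>c \<in> ctrl_adm P x. 0 \<le> \<mu> x c" "\<forall>y \<in> states P. 0 \<le> V y"
  shows "0 \<le> backup_ctrl P V x \<mu> a"
  unfolding backup_ctrl_def
  using assms by (intro sum_nonneg mult_nonneg_nonneg add_nonneg_nonneg tprob_nonneg weight_nonneg) auto

lemma uniform_policy: "ctrl_policy P (\<lambda>x c. 1 / real (card (ctrl_adm P x)))"
  using finite_ctrl ctrl_nonempty by (auto simp: ctrl_policy_def)

lemma perceived_policy:
  assumes "ctrl_policy P \<mu>" "0 \<le> \<alpha>" "\<alpha> \<le> 1"
  shows "ctrl_policy P (perceived P \<alpha> \<mu>)"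
  unfolding ctrl_policy_def
proof (intro ballI conjI)
  fix x assume x: "x \<in> states P"
  show "0 \<le> perceived P \<alpha> \<mu> x c" if "c \<in> ctrl_adm P x" for c
    using assms x that by (auto simp: perceived_def ctrl_policy_def)
  have "(\<Sum>c \<in> ctrl_adm P x. perceived P \<alpha> \<mu> x c)
      = \<alpha> * (\<Sum>c \<in> ctrl_adm P x. 1 / real (card (ctrl_adm P x)))
        + (1 - \<alpha>) * (\<Sum>c \<in> ctrl_adm P x. \<mu> x c)"
    unfolding perceived_def sum.distrib sum_distrib_left ..
  also have "\<dots> = 1"
    using assms x uniform_policy by (simp add: ctrl_policy_def)
  finally show "(\<Sum>c \<in> ctrl_adm P x. perceived P \<alpha> \<mu> x c) = 1" .
qed


subsection \<open>Expected total rewards\<close>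

text \<open>Averaged form of \<open>potential_step\<close>: after exchanging sums, weight and
  potential meet under the same transition probability, and the action probabilities sum to
  1.\<close>

lemma expected_reward_eq:
  assumes "ctrl_policy P \<mu>" "adv_policy P lam" "x \<in> states P"
  shows "(\<Sum>c \<in> ctrl_adm P x. \<Sum>a \<in> adv_adm P x. \<Sum>y \<in> states P.
            \<mu> x c * lam x a * tprob P x c a y * weight P x c a y)
         + (\<Sum>y \<in> states P. step_prob P \<mu> lam x y * R y) = R x"
proof -
  have "(\<Sum>y \<in> states P. step_prob P \<mu> lam x y * R y)
      = (\<Sum>c \<in> ctrl_adm P x. \<Sum>y \<in> states P. \<Sum>a \<in> adv_adm P x.
           \<mu> x c * lam x a * tprob P x c a y * R y)"
    unfolding step_prob_def sum_distrib_right by (rule sum.swap)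
  also have "\<dots> = (\<Sum>c \<in> ctrl_adm P x. \<Sum>a \<in> adv_adm P x. \<Sum>y \<in> states P.
           \<mu> x c * lam x a * tprob P x c a y * R y)"
    by (intro sum.cong refl sum.swap)
  finally have "(\<Sum>c \<in> ctrl_adm P x. \<Sum>a \<in> adv_adm P x. \<Sum>y \<in> states P.
            \<mu> x c * lam x a * tprob P x c a y * weight P x c a y)
         + (\<Sum>y \<in> states P. step_prob P \<mu> lam x y * R y)
      = (\<Sum>c \<in> ctrl_adm P x. \<Sum>a \<in> adv_adm P x. \<mu> x c * lam x a *
           (\<Sum>y \<in> states P. tprob P x c a y * (weight P x c a y + R y)))"
    by (simp add: sum_distrib_left distrib_left sum.distrib mult.assoc)
  also have "\<dots> = (\<Sum>c \<in> ctrl_adm P x. \<Sum>a \<in> adv_adm P x. \<mu> x c * lam x a * R x)"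
    using assms(3) by (intro sum.cong refl) (simp add: expected_potential_step)
  also have "\<dots> = (\<Sum>c \<in> ctrl_adm P x. \<mu> x c) * (\<Sum>a \<in> adv_adm P x. lam x a) * R x"
    by (simp only: sum_product) (simp only: sum_distrib_right)
  also have "\<dots> = R x"
    using assms by (simp add: ctrl_policy_def adv_policy_def)
  finally show ?thesis .
qed

lemma visit_prob_nonneg:
  assumes "ctrl_policy P \<mu>" "adv_policy P lam" "y \<in> states P"
  shows "0 \<le> visit_prob P \<mu> lam x t y"
  using assms(3)
proof (induction t arbitrary: y)
  case (Suc t)
  have "0 \<le> step_prob P \<mu> lam z y" if "z \<in> states P" for z
    unfolding step_prob_def using assms that Suc.prems
    by (intro sum_nonneg mult_nonneg_nonneg tprob_nonneg)
      (auto simp: ctrl_policy_def adv_policy_def)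
  with Suc.IH show ?case
    by (auto intro!: sum_nonneg mult_nonneg_nonneg)
qed simp

text \<open>Reward is paid out of the potential, so partial sums never exceed \<open>R x\<close>.
  The summability obtained along the way justifies the bounds on the infinite sum and its change of
  sign.\<close>

lemma total_reward_bounds:
  assumes "ctrl_policy P \<mu>" "adv_policy P lam" "x \<in> states P"
  shows "0 \<le> total_reward P (weight P) \<mu> lam x"
    and "total_reward P (weight P) \<mu> lam x \<le> R x"
    and "total_reward P (neg_weight P) \<mu> lam x = - total_reward P (weight P) \<mu> lam x"
proof -
  define \<rho> where "\<rho> y = (\<Sum>c \<in> ctrl_adm P y. \<Sum>a \<in> adv_adm P y. \<Sum>y' \<in> states P.
      \<mu> y c * lam y a * tprob P y c a y' * weight P y c a y')" for y
  define f where "f t = (\<Sum>y \<in> states P. visit_prob P \<mu> lam x t y * \<rho> y)" for t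
  have "0 \<le> \<rho> y" if "y \<in> states P" for y
    unfolding \<rho>_def using assms that
    by (intro sum_nonneg mult_nonneg_nonneg tprob_nonneg weight_nonneg)
      (auto simp: ctrl_policy_def adv_policy_def)
  then have f_nonneg: "0 \<le> f t" for t
    unfolding f_def using assms by (intro sum_nonneg mult_nonneg_nonneg visit_prob_nonneg)
  \<comment> \<open>Conservation: the reward expected before time \<open>T\<close> plus the expected
    potential at time \<open>T\<close> is always the initial potential.\<close>
  have telescope: "(\<Sum>t<T. f t) + (\<Sum>y \<in> states P. visit_prob P \<mu> lam x T y * R y) = R x" for T
  proof (induction T)
    case 0
    have "(\<Sum>y \<in> states P. (if y = x then 1 else 0) * R y) = (\<Sum>y \<in> states P. if y = x then R y else 0)"
      by (intro sum.cong) auto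
    then show ?case
      using assms(3) finite_states by simp
  next
    case (Suc T)
    have "(\<Sum>y \<in> states P. visit_prob P \<mu> lam x (Suc T) y * R y)
        = (\<Sum>y \<in> states P. \<Sum>z \<in> states P.
             visit_prob P \<mu> lam x T z * (step_prob P \<mu> lam z y * R y))"
      by (simp add: sum_distrib_right mult.assoc)
    also have "\<dots> = (\<Sum>z \<in> states P. visit_prob P \<mu> lam x T z *
             (\<Sum>y \<in> states P. step_prob P \<mu> lam z y * R y))"
      unfolding sum_distrib_left by (rule sum.swap)
    finally have "f T + (\<Sum>y \<in> states P. visit_prob P \<mu> lam x (Suc T) y * R y)
        = (\<Sum>z \<in> states P. visit_prob P \<mu> lam x T z *
            (\<rho> z + (\<Sum>y \<in> states P. step_prob P \<mu> lam z y * R y)))"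
      by (simp add: f_def distrib_left sum.distrib)
    also have "\<dots> = (\<Sum>z \<in> states P. visit_prob P \<mu> lam x T z * R z)"
      unfolding \<rho>_def using assms by (intro sum.cong refl) (simp add: expected_reward_eq)
    finally show ?case
      using Suc.IH by simp
  qed
  have partial: "(\<Sum>t<T. f t) \<le> R x" for T
    using telescope[of T] sum_nonneg[of "states P" "\<lambda>y. visit_prob P \<mu> lam x T y * R y"]
      visit_prob_nonneg[OF assms(1,2)] potential_nonneg by force
  have "summable f"
    using f_nonneg partial by (intro summableI_nonneg_bounded)
  then show "0 \<le> total_reward P (weight P) \<mu> lam x" "total_reward P (weight P) \<mu> lam x \<le> R x"
    unfolding total_reward_def \<rho>_def[symmetric] f_def[symmetric]
    using f_nonneg partial by (auto intro: suminf_nonneg suminf_le_const)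
  have "total_reward P (neg_weight P) \<mu> lam x = (\<Sum>t. - f t)"
    by (simp add: total_reward_def neg_weight_def f_def \<rho>_def sum_negf)
  also have "\<dots> = - total_reward P (weight P) \<mu> lam x"
    unfolding total_reward_def \<rho>_def[symmetric] f_def[symmetric]
    using \<open>summable f\<close> by (rule suminf_minus)
  finally show "total_reward P (neg_weight P) \<mu> lam x = - total_reward P (weight P) \<mu> lam x" .
qed


subsection \<open>Feasibility and optimal solutions of the program\<close>

text \<open>The invariant of the algorithm. \<open>VC\<close> gets no lower bound because the
  program bounds it only from above: where \<gamma> vanishes, an optimal solution may be arbitrarily
  low.\<close>

definition valid_values :: "('x \<Rightarrow> real) \<Rightarrow> ('x \<Rightarrow> real) \<Rightarrow> bool" where
  "valid_values VC VA \<longleftrightarrow> (\<forall>x \<in> states P. VC x \<le> R x \<and> - R x \<le> VA x \<and> VA x \<le> 0)"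

lemma initial_values_valid:
  assumes "initial_values P \<alpha> \<mu> V" "0 \<le> \<alpha>" "\<alpha> \<le> 1"
  shows "valid_values (fst V) (snd V)"
proof -
  obtain lam where "ctrl_policy P \<mu>" "adv_policy P lam"
    and "\<forall>x \<in> states P. fst V x = total_reward P (weight P) \<mu> lam x \<and>
           snd V x = total_reward P (neg_weight P) (perceived P \<alpha> \<mu>) lam x"
    using assms(1) by (auto simp: initial_values_def best_response_def)
  moreover have "ctrl_policy P (perceived P \<alpha> \<mu>)"
    using \<open>ctrl_policy P \<mu>\<close> assms(2,3) by (rule perceived_policy)
  ultimately show ?thesis
    using total_reward_bounds by (simp add: valid_values_def)
qed

section \<open>One program with valid data\<close>

context
  fixes \<alpha> Z :: real and VCk VAk :: "'x \<Rightarrow> real"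
  assumes \<alpha>: "0 \<le> \<alpha>" "\<alpha> \<le> 1" and valid: "valid_values VCk VAk"
begin

lemma perceived_distribution:
  assumes "x \<in> states P" "\<forall>c \<in> ctrl_adm P x. 0 \<le> m c" "(\<Sum>c \<in> ctrl_adm P x. m c) = 1"
  shows "\<forall>c \<in> ctrl_adm P x. 0 \<le> perceived P \<alpha> (\<lambda>_. m) x c"
    and "(\<Sum>c \<in> ctrl_adm P x. perceived P \<alpha> (\<lambda>_. m) x c) = 1"
proof -
  \<comment> \<open>The distribution \<open>m\<close> is extended to a policy by the uniform one at
    the other states, so that \<open>perceived_policy\<close> applies.\<close>
  define \<mu> where "\<mu> y = (if y = x then m else (\<lambda>c. 1 / real (card (ctrl_adm P y))))" for y
  have "ctrl_policy P \<mu>"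
    using uniform_policy assms by (auto simp: \<mu>_def ctrl_policy_def)
  then have "ctrl_policy P (perceived P \<alpha> \<mu>)"
    using \<alpha> by (rule perceived_policy)
  moreover have "perceived P \<alpha> \<mu> x c = perceived P \<alpha> (\<lambda>_. m) x c" for c
    by (simp add: perceived_def \<mu>_def)
  ultimately show "\<forall>c \<in> ctrl_adm P x. 0 \<le> perceived P \<alpha> (\<lambda>_. m) x c"
    "(\<Sum>c \<in> ctrl_adm P x. perceived P \<alpha> (\<lambda>_. m) x c) = 1"
    using assms(1) unfolding ctrl_policy_def by auto
qed

text \<open>\<open>- VAk\<close> lies between 0 and \<open>R\<close>, so the sign change
  \<open>backup_adv_eq\<close> transfers the bounds on the controller's backups.\<close>

lemma backup_adv_bounds:
  assumes "x \<in> states P" "a \<in> adv_adm P x"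
    and "\<forall>c \<in> ctrl_adm P x. 0 \<le> m c" "(\<Sum>c \<in> ctrl_adm P x. m c) = 1"
  shows "- R x \<le> backup_adv P VAk x (perceived P \<alpha> (\<lambda>_. m)) a"
    and "backup_adv P VAk x (perceived P \<alpha> (\<lambda>_. m)) a \<le> 0"
proof -
  note p = perceived_distribution[OF assms(1,3,4)]
  have V: "\<forall>y \<in> states P. - VAk y \<le> R y" "\<forall>y \<in> states P. 0 \<le> - VAk y"
    using valid by (auto simp: valid_values_def minus_le_iff)
  show "- R x \<le> backup_adv P VAk x (perceived P \<alpha> (\<lambda>_. m)) a"
    using backup_ctrl_le[where V = "\<lambda>y. - VAk y" and \<mu> = "perceived P \<alpha> (\<lambda>_. m)",
        OF assms(1,2) p V(1)] by (simp add: backup_adv_eq)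
  show "backup_adv P VAk x (perceived P \<alpha> (\<lambda>_. m)) a \<le> 0"
    using backup_ctrl_nonneg[where V = "\<lambda>y. - VAk y" and \<mu> = "perceived P \<alpha> (\<lambda>_. m)",
        OF assms(1,2) p(1) V(2)] by (simp add: backup_adv_eq)
qed

text \<open>At the selected action, \<open>vc\<close> is at most a backup and \<open>va\<close>
  equals one; the backups of valid data obey these bounds.\<close>

lemma state_feasible_bounds:
  assumes "x \<in> states P" "state_feasible P \<alpha> Z VCk VAk x m l vc va"
  shows "vc \<le> R x" "- R x \<le> va" "va \<le> 0"
proof -
  obtain a where a: "a \<in> adv_adm P x" "l a = 1"
    using assms(2) by (rule state_feasible_selects_action)
  have m: "\<forall>c \<in> ctrl_adm P x. 0 \<le> m c" "(\<Sum>c \<in> ctrl_adm P x. m c) = 1"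
    using assms(2) by (auto simp: state_feasible_def)
  have c: "vc \<le> backup_ctrl P VCk x (\<lambda>_. m) a"
    and e: "va = backup_adv P VAk x (perceived P \<alpha> (\<lambda>_. m)) a"
    using assms(2) a by (force simp: state_feasible_def)+
  have "\<forall>y \<in> states P. VCk y \<le> R y"
    using valid by (auto simp: valid_values_def)
  with c show "vc \<le> R x"
    using backup_ctrl_le[of x a "\<lambda>_. m" VCk] assms(1) a m by force
  show "- R x \<le> va" "va \<le> 0"
    unfolding e using backup_adv_bounds assms(1) a m by auto
qed

lemma milp_feasible_valid:
  assumes "milp_feasible P \<alpha> Z VCk VAk \<mu> lam VC VA"
  shows "valid_values VC VA"
  using assms state_feasible_bounds unfolding milp_feasible_iff valid_values_def by blast

text \<open>The controller plays uniformly and the adversary takes an action \<open>a0\<close>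
  maximising his backup. At the other actions the slack \<open>Z\<close> suffices, since all his
  backups lie in an interval of length \<open>R x\<close>.\<close>

lemma state_feasible_exists:
  assumes x: "x \<in> states P" and Z: "R x \<le> Z"
  shows "\<exists>m l vc va. state_feasible P \<alpha> Z VCk VAk x m l vc va"
proof -
  define m :: "'c \<Rightarrow> real" where "m c = 1 / real (card (ctrl_adm P x))" for c
  have m: "\<forall>c \<in> ctrl_adm P x. 0 \<le> m c" "(\<Sum>c \<in> ctrl_adm P x. m c) = 1"
    using uniform_policy x by (auto simp: ctrl_policy_def m_def)
  define b where "b = backup_adv P VAk x (perceived P \<alpha> (\<lambda>_. m))"
  define d where "d = backup_ctrl P VCk x (\<lambda>_. m)"
  have "finite (b ` adv_adm P x)" "b ` adv_adm P x \<noteq> {}"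
    using finite_adv adv_nonempty x by auto
  from Max_in[OF this] obtain a0 where a0: "a0 \<in> adv_adm P x" "b a0 = Max (b ` adv_adm P x)"
    by force
  have b: "b a \<le> b a0" "b a0 \<le> b a + Z" if "a \<in> adv_adm P x" for a
    using a0 finite_adv[OF x] that Z backup_adv_bounds[OF x that m] backup_adv_bounds[OF x a0(1) m]
    by (auto simp: b_def[symmetric])
  define l where "l a = (if a = a0 then 1 else 0 :: real)" for a
  \<comment> \<open>Being below every backup, \<open>vc\<close> meets the controller's constraint at
    all actions, selected or not.\<close>
  define vc where "vc = Min (d ` adv_adm P x)"
  have d: "vc \<le> d a" if "a \<in> adv_adm P x" for a
    using finite_adv[OF x] that by (simp add: vc_def)
  have "0 \<le> Z"
    using Z potential_nonneg[OF x] by simp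
  have "state_feasible P \<alpha> Z VCk VAk x m l vc (b a0)"
    unfolding state_feasible_def
    using m a0 b finite_adv[OF x] d \<open>0 \<le> Z\<close>
    by (auto simp: l_def b_def[symmetric] d_def[symmetric] add_increasing2)
  then show ?thesis by blast
qed

text \<open>A maximising sequence is followed along a convergent subsequence: the variables are
  bounded and every constraint survives the limit.\<close>

lemma state_optimum_exists:
  assumes x: "x \<in> states P" and "\<exists>m l vc va. state_feasible P \<alpha> Z VCk VAk x m l vc va"
  shows "\<exists>m l vc va. state_feasible P \<alpha> Z VCk VAk x m l vc va \<and>
           (\<forall>m' l' vc' va'. state_feasible P \<alpha> Z VCk VAk x m' l' vc' va' \<longrightarrow> vc' \<le> vc)"
proof -
  define S where "S = {vc. \<exists>m l va. state_feasible P \<alpha> Z VCk VAk x m l vc va}"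
  have "S \<noteq> {}"
    using assms(2) by (auto simp: S_def)
  have bdd: "bdd_above S"
    using state_feasible_bounds(1)[OF x] by (auto simp: S_def intro!: bdd_aboveI[of _ "R x"])
  have "\<exists>v m l va. state_feasible P \<alpha> Z VCk VAk x m l v va \<and> Sup S - inverse (real (Suc n)) < v" for n
    using less_cSup_iff[OF \<open>S \<noteq> {}\<close> bdd, of "Sup S - inverse (real (Suc n))"]
    by (auto simp: S_def)
  then obtain v m l va where feas: "\<And>n. state_feasible P \<alpha> Z VCk VAk x (m n) (l n) (v n) (va n)"
    and v_lower: "\<And>n. Sup S - inverse (real (Suc n)) < v n"
    by metis
  have v_upper: "v n \<le> Sup S" for n
    using feas by (intro cSup_upper bdd) (auto simp: S_def)
  have v_lim: "v \<longlonglongrightarrow> Sup S"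
  proof (rule tendsto_sandwich)
    show "(\<lambda>n. Sup S - inverse (real (Suc n))) \<longlonglongrightarrow> Sup S"
      using tendsto_diff[OF tendsto_const LIMSEQ_inverse_real_of_nat, of "Sup S"] by simp
    show "(\<lambda>n. Sup S) \<longlonglongrightarrow> Sup S" by simp
  qed (use v_lower v_upper in \<open>auto intro: always_eventually less_imp_le\<close>)
  \<comment> \<open>All variables except \<open>v\<close>, which already converges, are packed into
    one family, so that a single subsequence serves them all: \<open>None\<close> is
    \<open>va\<close>, \<open>Inl\<close> the controller's part, \<open>Inr\<close> the
    adversary's.\<close>
  define f where "f n i = (case i of None \<Rightarrow> va n | Some (Inl c) \<Rightarrow> m n c | Some (Inr a) \<Rightarrow> l n a)"
    for n i
  define I where "I = insert None (Some ` (ctrl_adm P x <+> adv_adm P x))"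
  have "finite I"
    using finite_ctrl finite_adv x by (simp add: I_def)
  moreover have "\<bar>f n i\<bar> \<le> R x + 1" if "i \<in> I" for n i
  proof -
    have "\<bar>m n c\<bar> \<le> 1" if "c \<in> ctrl_adm P x" for c
      using feas[of n] member_le_sum[of c "ctrl_adm P x" "m n"] finite_ctrl[OF x] that
      by (auto simp: state_feasible_def)
    moreover have "\<bar>l n a\<bar> \<le> 1" if "a \<in> adv_adm P x" for a
      using feas[of n] that by (auto simp: state_feasible_def)
    moreover have "\<bar>va n\<bar> \<le> R x"
      using state_feasible_bounds[OF x feas] by (simp add: abs_le_iff minus_le_iff)
    ultimately show ?thesis
      using that potential_nonneg[OF x] by (fastforce simp: I_def f_def)
  qed
  ultimately obtain \<tau> g where \<tau>: "strict_mono \<tau>"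
    and g: "\<forall>i \<in> I. (\<lambda>n. f (\<tau> n) i) \<longlonglongrightarrow> g i"
    using bounded_family_convergent_subseq[of I f] by metis
  define m' l' va' where "m' c = g (Some (Inl c))" and "l' a = g (Some (Inr a))"
    and "va' = g None" for c a
  have m': "(\<lambda>n. m (\<tau> n) c) \<longlonglongrightarrow> m' c" if "c \<in> ctrl_adm P x" for c
    using g[rule_format, of "Some (Inl c)"] that by (force simp: I_def f_def m'_def)
  have l': "(\<lambda>n. l (\<tau> n) a) \<longlonglongrightarrow> l' a" if "a \<in> adv_adm P x" for a
    using g[rule_format, of "Some (Inr a)"] that by (force simp: I_def f_def l'_def)
  have va': "(\<lambda>n. va (\<tau> n)) \<longlonglongrightarrow> va'"
    using g[rule_format, of None] by (simp add: I_def f_def va'_def)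
  have v': "(\<lambda>n. v (\<tau> n)) \<longlonglongrightarrow> Sup S"
    using LIMSEQ_subseq_LIMSEQ[OF v_lim \<tau>] by (simp add: o_def)
  have bc: "(\<lambda>n. backup_ctrl P VCk x (\<lambda>_. m (\<tau> n)) a) \<longlonglongrightarrow> backup_ctrl P VCk x (\<lambda>_. m') a" for a
    unfolding backup_ctrl_def by (intro tendsto_intros m')
  have ba: "(\<lambda>n. backup_adv P VAk x (perceived P \<alpha> (\<lambda>_. m (\<tau> n))) a)
      \<longlonglongrightarrow> backup_adv P VAk x (perceived P \<alpha> (\<lambda>_. m')) a" for a
    unfolding backup_adv_def perceived_def by (intro tendsto_intros m')
  have "state_feasible P \<alpha> Z VCk VAk x m' l' (Sup S) va'"
    unfolding state_feasible_def
  proof (intro conjI ballI)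
    fix c assume "c \<in> ctrl_adm P x"
    then show "0 \<le> m' c"
      using feas by (intro LIMSEQ_le_const[OF m']) (auto simp: state_feasible_def)
  next
    have "(\<lambda>n. \<Sum>c \<in> ctrl_adm P x. m (\<tau> n) c) \<longlonglongrightarrow> (\<Sum>c \<in> ctrl_adm P x. m' c)"
      by (intro tendsto_intros m')
    moreover have "(\<lambda>n. \<Sum>c \<in> ctrl_adm P x. m (\<tau> n) c) = (\<lambda>n. 1)"
      using feas by (simp add: state_feasible_def)
    ultimately show "(\<Sum>c \<in> ctrl_adm P x. m' c) = 1"
      by (simp add: LIMSEQ_const_iff)
  next
    have "(\<lambda>n. \<Sum>a \<in> adv_adm P x. l (\<tau> n) a) \<longlonglongrightarrow> (\<Sum>a \<in> adv_adm P x. l' a)"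
      by (intro tendsto_intros l')
    moreover have "(\<lambda>n. \<Sum>a \<in> adv_adm P x. l (\<tau> n) a) = (\<lambda>n. 1)"
      using feas by (simp add: state_feasible_def)
    ultimately show "(\<Sum>a \<in> adv_adm P x. l' a) = 1"
      by (simp add: LIMSEQ_const_iff)
  next
    fix a assume a: "a \<in> adv_adm P x"
    \<comment> \<open>Integrality becomes a closed condition once written as
      \<open>l * (1 - l) = 0\<close>.\<close>
    have "(\<lambda>n. l (\<tau> n) a * (1 - l (\<tau> n) a)) \<longlonglongrightarrow> l' a * (1 - l' a)"
      by (intro tendsto_intros l' a)
    moreover have "(\<lambda>n. l (\<tau> n) a * (1 - l (\<tau> n) a)) = (\<lambda>n. 0)"
      using feas a by (fastforce simp: state_feasible_def)
    ultimately show "l' a \<in> {0, 1}"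
      by (simp add: LIMSEQ_const_iff)
    have slack: "(\<lambda>n. (1 - l (\<tau> n) a) * Z) \<longlonglongrightarrow> (1 - l' a) * Z"
      by (intro tendsto_intros l' a)
    show "Sup S \<le> backup_ctrl P VCk x (\<lambda>_. m') a + (1 - l' a) * Z"
      by (rule LIMSEQ_le[OF v' tendsto_add[OF bc slack]])
        (use feas a in \<open>auto simp: state_feasible_def\<close>)
    show "backup_adv P VAk x (perceived P \<alpha> (\<lambda>_. m')) a \<le> va'"
      by (rule LIMSEQ_le[OF ba va']) (use feas a in \<open>auto simp: state_feasible_def\<close>)
    show "va' \<le> backup_adv P VAk x (perceived P \<alpha> (\<lambda>_. m')) a + (1 - l' a) * Z"
      by (rule LIMSEQ_le[OF va' tendsto_add[OF ba slack]])
        (use feas a in \<open>auto simp: state_feasible_def\<close>)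
  qed
  moreover have "vc \<le> Sup S" if "state_feasible P \<alpha> Z VCk VAk x m l vc va" for m l vc va
    using that by (intro cSup_upper bdd) (auto simp: S_def)
  ultimately show ?thesis by blast
qed

text \<open>No constraint links two states and \<gamma> is nonnegative, so optima of the single
  states combine to an optimum of the program.\<close>

lemma milp_optimal_exists:
  assumes \<gamma>: "\<forall>x \<in> states P. 0 \<le> \<gamma> x" and Z: "\<forall>x \<in> states P. R x \<le> Z"
  shows "\<exists>\<mu> lam VC VA. milp_optimal P \<gamma> \<alpha> Z VCk VAk \<mu> lam VC VA"
proof -
  have "\<forall>x \<in> states P. \<exists>m l vc va. state_feasible P \<alpha> Z VCk VAk x m l vc va \<and>
      (\<forall>m' l' vc' va'. state_feasible P \<alpha> Z VCk VAk x m' l' vc' va' \<longrightarrow> vc' \<le> vc)"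
    using state_optimum_exists state_feasible_exists Z by blast
  then obtain \<mu> lam VC VA where
    feas: "\<forall>x \<in> states P. state_feasible P \<alpha> Z VCk VAk x (\<mu> x) (lam x) (VC x) (VA x)"
    and opt: "\<forall>x \<in> states P. \<forall>m' l' vc' va'.
      state_feasible P \<alpha> Z VCk VAk x m' l' vc' va' \<longrightarrow> vc' \<le> VC x"
    by (simp only: bchoice_iff) blast
  have "objective P \<gamma> VC' \<le> objective P \<gamma> VC" if "milp_feasible P \<alpha> Z VCk VAk \<mu>' lam' VC' VA'"
    for \<mu>' lam' VC' VA'
  proof -
    have "VC' x \<le> VC x" if "x \<in> states P" for x
      using that opt \<open>milp_feasible P \<alpha> Z VCk VAk \<mu>' lam' VC' VA'\<close>
      unfolding milp_feasible_iff by blast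
    with \<gamma> show ?thesis
      unfolding objective_def by (intro sum_mono mult_left_mono) auto
  qed
  with feas show ?thesis
    unfolding milp_optimal_def milp_feasible_iff by blast
qed

lemma not_milp_infeasible:
  assumes "\<forall>x \<in> states P. R x \<le> Z"
  shows "\<not> milp_infeasible P \<alpha> Z VCk VAk"
  using milp_optimal_exists[of "\<lambda>_. 0"] assms
  by (force simp: milp_infeasible_def milp_optimal_def)

end


subsection \<open>Termination\<close>

text \<open>A lexicographic rank decreases: outer progress first, then the number of improvements
  left to the current inner loop.\<close>

lemma algorithm_terminates:
  assumes \<gamma>: "\<forall>x \<in> states P. 0 \<le> \<gamma> x" and \<alpha>: "0 \<le> \<alpha>" "\<alpha> \<le> 1"
    and Z: "\<forall>x \<in> states P. R x \<le> Z" and \<epsilon>: "0 < \<epsilon>"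
    and H: "H \<noteq> []" "\<forall>(VC, VA) \<in> set H. valid_values VC VA"
  shows "algorithm_terminates P \<gamma> \<alpha> Z \<epsilon> H"
  unfolding algorithm_terminates_def
proof (rule terminatesI)
  \<comment> \<open>An exhausted list forces \<V> to be nonempty, which excludes
    \<open>repeat_outer\<close>. This holds at the start by \<open>H \<noteq> []\<close> and
    persists since \<open>infeasible_inner\<close> cannot occur.\<close>
  define Inv :: "('x, 'c) config \<Rightarrow> bool" where "Inv d = (case d of
      Outer vs \<V> \<Rightarrow> (\<forall>(VC, VA) \<in> set vs. valid_values VC VA) \<and> finite \<V> \<and> (vs = [] \<longrightarrow> \<V> \<noteq> {})
    | Inner vs \<V> VC VA \<Rightarrow>
        (\<forall>(VC, VA) \<in> set vs. valid_values VC VA) \<and> finite \<V> \<and> valid_values VC VA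
    | Returned \<mu> \<Rightarrow> True)" for d
  \<comment> \<open>Each pending vector counts 2, as its inner loop is entered and left once; the
    offsets place \<open>Inner\<close> between the two \<open>Outer\<close> configurations around it
    and keep \<open>Outer []\<close> above \<open>Returned\<close>.\<close>
  define rank :: "('x, 'c) config \<Rightarrow> nat \<times> nat" where "rank d = (case d of
      Outer vs \<V> \<Rightarrow> (2 * length vs + 1, 0)
    | Inner vs \<V> VC VA \<Rightarrow>
        (2 * length vs + 2, nat \<lceil>(objective P \<gamma> R - objective P \<gamma> VC) / \<epsilon>\<rceil>)
    | Returned \<mu> \<Rightarrow> (0, 0))" for d
  show "wf (inv_image (less_than <*lex*> less_than) rank)"
    by auto
  show "Inv (Outer H {})"
    using H by (simp add: Inv_def)
  show "Inv d' \<and> (d', d) \<in> inv_image (less_than <*lex*> less_than) rank"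
    if "Inv d" and "alg_step P \<gamma> \<alpha> Z \<epsilon> H d d'" for d d'
    using that(2,1)
  proof cases
    case (continue_inner VCk VAk \<mu> lam VC VA vs \<V>)
    have "valid_values VCk VAk" "milp_feasible P \<alpha> Z VCk VAk \<mu> lam VC VA"
      using that(1) continue_inner(1,3) by (simp_all add: Inv_def milp_optimal_def)
    then have "valid_values VC VA"
      by (rule milp_feasible_valid[OF \<alpha>])
    moreover from this have "objective P \<gamma> VC \<le> objective P \<gamma> R"
      unfolding objective_def using \<gamma>
      by (intro sum_mono mult_left_mono) (auto simp: valid_values_def)
    moreover from this have "nat \<lceil>(objective P \<gamma> R - objective P \<gamma> VC) / \<epsilon>\<rceil>
        < nat \<lceil>(objective P \<gamma> R - objective P \<gamma> VCk) / \<epsilon>\<rceil>"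
      using continue_inner(4) by (intro nat_ceiling_divide_decreasing[OF \<epsilon>]) auto
    ultimately show ?thesis
      using that(1) continue_inner(1,2) by (simp add: Inv_def rank_def)
  next
    case (infeasible_inner VCk VAk vs \<V>)
    then have "valid_values VCk VAk"
      using that(1) by (simp add: Inv_def)
    with infeasible_inner show ?thesis
      using not_milp_infeasible[OF \<alpha> _ Z] by blast
  qed (auto simp: Inv_def rank_def)
  show "\<exists>d'. alg_step P \<gamma> \<alpha> Z \<epsilon> H d d'" if "Inv d" and "\<not> (\<exists>\<mu>. d = Returned \<mu>)" for d
  proof (cases d)
    case (Outer vs \<V>)
    show ?thesis
    proof (cases vs)
      case Nil
      with that Outer have "finite (fst ` \<V>)" "fst ` \<V> \<noteq> {}"
        by (auto simp: Inv_def)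
      from Max_in[OF this] obtain v \<mu> where "(v, \<mu>) \<in> \<V>" "v = Max (fst ` \<V>)"
        by force
      moreover have "v' \<le> v" if "(v', \<mu>') \<in> \<V>" for v' \<mu>'
        using Max_ge[OF \<open>finite (fst ` \<V>)\<close>, of v'] imageI[OF that, of fst]
        by (simp add: \<open>v = Max (fst ` \<V>)\<close>)
      ultimately show ?thesis
        unfolding Outer Nil by (intro exI[of _ "Returned \<mu>"] alg_step.finish) auto
    next
      case (Cons V vs')
      then show ?thesis
        unfolding Outer by (cases V) (use alg_step.start_inner in blast)
    qed
  next
    case (Inner vs \<V> VCk VAk)
    then have "valid_values VCk VAk"
      using that by (simp add: Inv_def)
    from milp_optimal_exists[OF \<alpha> this \<gamma> Z] obtain \<mu> lam VC VA
      where opt: "milp_optimal P \<gamma> \<alpha> Z VCk VAk \<mu> lam VC VA" by blast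
    show ?thesis
      unfolding Inner
      using alg_step.continue_inner[OF opt, of \<epsilon>] alg_step.stop_inner[OF opt, of \<epsilon>]
      by (cases "objective P \<gamma> VC - objective P \<gamma> VCk > \<epsilon>") (blast, blast intro: leI)
  qed (use that in auto)
qed

end


section \<open>The potential of the product game\<close>

definition remaining_reward ::
  "nat \<Rightarrow> (nat \<Rightarrow> 'p scltl) \<Rightarrow> ('p scltl \<Rightarrow> real) \<Rightarrow> (nat \<Rightarrow> ('q, 'p) dfa) \<Rightarrow> 's \<times> (nat \<Rightarrow> 'q) \<Rightarrow> real"
  where "remaining_reward n \<phi> r A x = (\<Sum>i = 1..n. if snd x i \<notin> dacc (A i) then r (\<phi> i) else 0)"

text \<open>The automata are deterministic and complete, so each game successor \<open>s'\<close>
  carries exactly one tuple of automaton states, \<open>succ s'\<close>; the inner sum collapses to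
  \<open>tprob G s c a s'\<close>.\<close>

lemma product_game_tprob_sum:
  assumes "stochastic_game G" "scltl_specs (props G) n \<phi> r A"
    and "s \<in> states G" "q \<in> (\<Pi>\<^sub>E i \<in> {1..n}. dstates (A i))"
    and "c \<in> ctrl_adm G s" "a \<in> adv_adm G s"
  shows "(\<Sum>y \<in> states (product_game G n \<phi> r A). tprob (product_game G n \<phi> r A) (s, q) c a y) = 1"
proof -
  define Q where "Q = (\<Pi>\<^sub>E i \<in> {1..n}. dstates (A i))"
  \<comment> \<open>Restricted to \<open>{1..n}\<close>: families in \<open>Q\<close> are
    extensional, so agreement on these indices amounts to equality.\<close>
  define succ where "succ s' = (\<lambda>i \<in> {1..n}. dnext (A i) (q i) (label G s'))" for s'
  have "finite Q"
    using assms(2) by (auto simp: Q_def scltl_specs_def good_prefix_dfa_def intro!: finite_PiE)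
  have succ: "succ s' \<in> Q" if "s' \<in> states G" for s'
    using assms that
    by (auto simp: Q_def succ_def stochastic_game_def scltl_specs_def good_prefix_dfa_def PiE_iff)
  have iff: "(\<forall>i \<in> {1..n}. dnext (A i) (q i) (label G s') = q' i) \<longleftrightarrow> q' = succ s'" if "q' \<in> Q" for s' q'
    using that by (auto simp: Q_def succ_def PiE_iff extensional_def fun_eq_iff restrict_def)
  have "(\<Sum>y \<in> states (product_game G n \<phi> r A). tprob (product_game G n \<phi> r A) (s, q) c a y)
      = (\<Sum>s' \<in> states G. \<Sum>q' \<in> Q.
           if \<forall>i \<in> {1..n}. dnext (A i) (q i) (label G s') = q' i then tprob G s c a s' else 0)"
    by (simp add: product_game_def Q_def sum.cartesian_product case_prod_beta cong: if_cong)
  also have "\<dots> = (\<Sum>s' \<in> states G. \<Sum>q' \<in> Q. if q' = succ s' then tprob G s c a s' else 0)"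
    by (intro sum.cong refl) (simp only: iff)
  also have "\<dots> = (\<Sum>s' \<in> states G. tprob G s c a s')"
    using succ \<open>finite Q\<close> by (intro sum.cong refl) simp
  also have "\<dots> = 1"
    using assms by (simp add: stochastic_game_def)
  finally show ?thesis .
qed

text \<open>A possible transition follows the automata, whose accepting states are absorbing. Hence
  a specification either keeps its status or is newly satisfied, and then its reward moves from the
  potential to the weight.\<close>

lemma product_game_potential_step:
  assumes "stochastic_game G" "scltl_specs (props G) n \<phi> r A"
    and "x \<in> states (product_game G n \<phi> r A)" "y \<in> states (product_game G n \<phi> r A)"
    and "tprob (product_game G n \<phi> r A) x c a y \<noteq> 0"
  shows "weight (product_game G n \<phi> r A) x c a y + remaining_reward n \<phi> r A y
    = remaining_reward n \<phi> r A x"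
proof -
  obtain s q s' q' where x: "x = (s, q)" and y: "y = (s', q')"
    by (cases x, cases y)
  have "label G s' \<subseteq> props G"
    using assms(1,4) y by (auto simp: stochastic_game_def product_game_def)
  moreover have "dnext (A i) (q i) (label G s') = q' i" if "i \<in> {1..n}" for i
    using assms(5) that by (auto simp: x y product_game_def split: if_splits)
  moreover have "\<forall>q \<in> dacc (A i). \<forall>\<sigma> \<in> Pow (props G). dnext (A i) q \<sigma> \<in> dacc (A i)"
    if "i \<in> {1..n}" for i
    using assms(2) that by (simp add: scltl_specs_def good_prefix_dfa_def)
  ultimately have "q' i \<in> dacc (A i)" if "i \<in> {1..n}" "q i \<in> dacc (A i)" for i
    using that by (metis Pow_iff)
  then show ?thesis
    unfolding x y product_game_def remaining_reward_def
    by (simp flip: sum.distrib) (intro sum.cong refl, auto)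
qed

lemma product_potential_game:
  assumes G: "stochastic_game G" and specs: "scltl_specs (props G) n \<phi> r A"
  shows "potential_game (product_game G n \<phi> r A) (remaining_reward n \<phi> r A)"
    (is "potential_game ?P ?R")
proof
  show "finite (states ?P)"
    using G specs
    by (auto simp: product_game_def stochastic_game_def scltl_specs_def good_prefix_dfa_def
        intro!: finite_PiE)
next
  fix x assume x: "x \<in> states ?P"
  then obtain s q where sq: "x = (s, q)" "s \<in> states G" "q \<in> (\<Pi>\<^sub>E i \<in> {1..n}. dstates (A i))"
    by (auto simp: product_game_def)
  have adm: "ctrl_adm ?P x = ctrl_adm G s" "adv_adm ?P x = adv_adm G s"
    by (simp_all add: product_game_def sq)
  show "finite (ctrl_adm ?P x)" "finite (adv_adm ?P x)"
    "ctrl_adm ?P x \<noteq> {}" "adv_adm ?P x \<noteq> {}"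
    unfolding adm using G sq(2) unfolding stochastic_game_def by (meson finite_subset)+
  show "0 \<le> ?R x"
    unfolding remaining_reward_def using specs by (intro sum_nonneg) (auto simp: scltl_specs_def)
  show "(\<Sum>y \<in> states ?P. tprob ?P x c a y) = 1"
    if "c \<in> ctrl_adm ?P x" "a \<in> adv_adm ?P x" for c a
    using product_game_tprob_sum[OF G specs sq(2,3)] that unfolding adm by (simp add: sq(1))
  fix c a y assume y: "y \<in> states ?P"
  then obtain s' q' where sq': "y = (s', q')" "s' \<in> states G"
    by (auto simp: product_game_def)
  show "0 \<le> tprob ?P x c a y" if "c \<in> ctrl_adm ?P x" "a \<in> adv_adm ?P x"
    using that G sq(2) sq'(2) unfolding adm
    by (simp add: product_game_def sq(1) sq'(1) stochastic_game_def)
  show "0 \<le> weight ?P x c a y"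
    using specs
    by (auto simp: product_game_def sq(1) sq'(1) scltl_specs_def intro!: sum_nonneg)
  show "weight ?P x c a y + ?R y = ?R x" if "tprob ?P x c a y \<noteq> 0"
    using G specs x y that by (rule product_game_potential_step)
qed

text \<open>That \<open>Z\<close> is sufficiently large is expressed by \<open>at_top\<close>. The
  threshold found, the sum of all rewards, depends neither on \<epsilon> nor on the sampled
  policies.\<close>

theorem theorem1:
  fixes G :: "('s, 'c, 'a, 'p) labelled_game"
    and n :: nat
    and \<phi> :: "nat \<Rightarrow> 'p scltl"
    and r :: "'p scltl \<Rightarrow> real"
    and A :: "nat \<Rightarrow> ('q, 'p) dfa"
    and \<gamma> :: "'s \<times> (nat \<Rightarrow> 'q) \<Rightarrow> real"
    and \<alpha> :: real
  defines "P \<equiv> product_game G n \<phi> r A"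
  assumes "stochastic_game G"
    and "scltl_specs (props G) n \<phi> r A"
    and "state_distribution P \<gamma>"
    and "0 \<le> \<alpha>" "\<alpha> \<le> 1"
  shows "\<forall>\<^sub>F Z in at_top. \<forall>\<epsilon> > 0. \<forall>\<mu>s H.
           \<mu>s \<noteq> [] \<longrightarrow> list_all2 (initial_values P \<alpha>) \<mu>s H \<longrightarrow>
           algorithm_terminates P \<gamma> \<alpha> Z \<epsilon> H"
proof -
  interpret potential_game P "remaining_reward n \<phi> r A"
    unfolding P_def using assms(2,3) by (rule product_potential_game)
  have \<gamma>: "\<forall>x \<in> states P. 0 \<le> \<gamma> x"
    using assms(4) by (simp add: state_distribution_def)
  \<comment> \<open>Rewards are nonnegative, so no state can have more left to collect than all of
    them together.\<close>
  have R: "remaining_reward n \<phi> r A x \<le> (\<Sum>i = 1..n. r (\<phi> i))" for x :: "'s \<times> (nat \<Rightarrow> 'q)"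
    unfolding remaining_reward_def using assms(3) by (intro sum_mono) (auto simp: scltl_specs_def)
  have "algorithm_terminates P \<gamma> \<alpha> Z \<epsilon> H"
    if Z: "(\<Sum>i = 1..n. r (\<phi> i)) \<le> Z" and \<epsilon>: "0 < \<epsilon>"
      and H: "\<mu>s \<noteq> []" "list_all2 (initial_values P \<alpha>) \<mu>s H" for Z \<epsilon> \<mu>s H
  proof (rule algorithm_terminates[OF \<gamma> assms(5,6) _ \<epsilon>])
    show "\<forall>x \<in> states P. remaining_reward n \<phi> r A x \<le> Z"
      using R Z order_trans by blast
    show "H \<noteq> []"
      using H by auto
    show "\<forall>(VC, VA) \<in> set H. valid_values VC VA"
      using H(2) initial_values_valid[OF _ assms(5,6)]
      by (fastforce simp: list_all2_conv_all_nth in_set_conv_nth)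
  qed
  then show ?thesis
    by (intro eventually_at_top_linorderI[of "\<Sum>i = 1..n. r (\<phi> i)"]) blast
qed

end
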